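(* Let $G=(V,E)$ be an arbitrary tree with boundary $B=\{v_1,\ldots,v_n\}\subset V$ consisting of $n$ elements, let $\varphi: B\to\mathbb{R}^m$ be an arbitrary mapping, and put $z_k=\varphi(v_k)$, $z=(z_1,\ldots,z_n)\in\mathbb{R}^{mn}$ and $\rho_\varphi(\theta)=\langle\theta,z\rangle$ for $\theta\in\mathbb{R}^{mn}$. Then the length of each extreme network of the type $G$ with the boundary $\varphi$ is equal to the largest value of the linear function $\rho_\varphi$ on the convex set $|S_G|\subset\mathbb{R}^{mn}$.
   Context: Trees are finite. A boundary of a tree $G=(V,E)$ is a fixed subset $B=\{v_1,\ldots,v_n\}\subset V$ (with $v_1,\dots,v_n$ distinct) containing all vertices of $G$ of degree $1$ or $2$; the remaining vertices $v_{n+1},\ldots,v_{n+s}$ are called interior. A network of type $G$ in $\mathbb{R}^m$ is an arbitrary mapping $\Gamma: V\to\mathbb{R}^m$; its boundary is the restriction $\Gamma|_B$, and its length is $\sum_{vw\in E}\|\Gamma(v)-\Gamma(w)\|$ (edges may be degenerate, i.e. $\Gamma(v)=\Gamma(w)$ is allowed). $[G,\varphi]$ is the set of all networks of type $G$ in $\mathbb{R}^m$ with boundary $\varphi$. An extreme network of the type $G$ with the boundary $\varphi$ is an element of $[G,\varphi]$ whose length is minimal among all elements of $[G,\varphi]$. Points of $\mathbb{R}^{mn}$ are written $\theta=(\theta_1,\ldots,\theta_n)$ with $\theta_k\in\mathbb{R}^m$, and $\langle\cdot,\cdot\rangle$ is the Euclidean scalar product on $\mathbb{R}^{mn}$. For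 an edge $e\in E$, let $G_1=(V_1,E_1)$, $G_2=(V_2,E_2)$ be the two connected components of $G\setminus e$ (the edge $e$ removed, its end vertices kept), and $B_r=B\cap V_r$. Choose one of $B_1,B_2$, written as $\{v_{k_1},\ldots,v_{k_p}\}$; $\sigma_e$ is the inequality $\bigl\|\sum_{q=1}^p\theta_{k_q}\bigr\|^2\le 1$. $\sigma$ is the vector equation $\sum_{k=1}^n\theta_k=0$. The system $S_G$ consists of $\sigma$ and the inequalities $\sigma_e$ for all $e\in E$, and $|S_G|\subset\mathbb{R}^{mn}$ is the set of all its solutions (in view of $\sigma$, it does not depend on which of $B_1,B_2$ is chosen for each $e$). *)

theory Defs
  imports "HOL-Analysis.Analysis"
begin

text \<open>
  A finite simple graph is given by its vertex set \<open>V\<close> and its edge set \<open>E\<close>, an edge being the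
  two-element set of its end vertices.
\<close>

definition simple_graph :: "'v set \<Rightarrow> 'v set set \<Rightarrow> bool" where
  "simple_graph V E \<longleftrightarrow> finite V \<and> (\<forall>e\<in>E. \<exists>u\<in>V. \<exists>w\<in>V. u \<noteq> w \<and> e = {u, w})"

definition reachable :: "'v set set \<Rightarrow> 'v \<Rightarrow> 'v \<Rightarrow> bool" where
  "reachable E u w \<longleftrightarrow> (u, w) \<in> {(x, y). {x, y} \<in> E}\<^sup>*"

definition graph_connected :: "'v set \<Rightarrow> 'v set set \<Rightarrow> bool" where
  "graph_connected V E \<longleftrightarrow> V \<noteq> {} \<and> (\<forall>u\<in>V. \<forall>w\<in>V. reachable E u w)"

definition graph_cycle :: "'v set set \<Rightarrow> 'v list \<Rightarrow> bool" where
  "graph_cycle E p \<longleftrightarrow> 3 \<le> length p \<and> distinct p \<and>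
     (\<forall>i<length p. {p ! i, p ! (Suc i mod length p)} \<in> E)"

definition graph_tree :: "'v set \<Rightarrow> 'v set set \<Rightarrow> bool" where
  "graph_tree V E \<longleftrightarrow> simple_graph V E \<and> graph_connected V E \<and> (\<nexists>p. graph_cycle E p)"

definition vertex_degree :: "'v set set \<Rightarrow> 'v \<Rightarrow> nat" where
  "vertex_degree E u = card {e \<in> E. u \<in> e}"

definition graph_boundary :: "'v set \<Rightarrow> 'v set set \<Rightarrow> 'v set \<Rightarrow> bool" where
  "graph_boundary V E B \<longleftrightarrow> B \<subseteq> V \<and> (\<forall>u\<in>V. vertex_degree E u \<in> {1, 2} \<longrightarrow> u \<in> B)"

definition graph_components :: "'v set \<Rightarrow> 'v set set \<Rightarrow> 'v set set" where
  "graph_components V E = (\<lambda>u. {w \<in> V. reachable E u w}) ` V"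

definition edge_length :: "('v \<Rightarrow> 'a::real_normed_vector) \<Rightarrow> 'v set \<Rightarrow> real" where
  "edge_length \<Gamma> e = (THE l. \<exists>u w. e = {u, w} \<and> l = norm (\<Gamma> u - \<Gamma> w))"

lemma edge_length_doubleton [simp]: "edge_length \<Gamma> {u, w} = norm (\<Gamma> u - \<Gamma> w)"
  unfolding edge_length_def
  by (rule the_equality) (auto simp: doubleton_eq_iff norm_minus_commute)

definition network_length :: "'v set set \<Rightarrow> ('v \<Rightarrow> 'a::real_normed_vector) \<Rightarrow> real" where
  "network_length E \<Gamma> = (\<Sum>e\<in>E. edge_length \<Gamma> e)"

text \<open>
  The networks with vertex set \<open>V\<close> and boundary \<open>\<phi>\<close>; only the values of \<open>\<phi>\<close> on \<open>B\<close> matter, so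
  \<open>\<phi>\<close> may be any total function extending the boundary mapping.
\<close>

definition networks :: "'v set \<Rightarrow> 'v set \<Rightarrow> ('v \<Rightarrow> 'a) \<Rightarrow> ('v \<Rightarrow> 'a) set" where
  "networks V B \<phi> = {\<Gamma> \<in> V \<rightarrow>\<^sub>E UNIV. \<forall>b\<in>B. \<Gamma> b = \<phi> b}"

definition extreme_network ::
    "'v set \<Rightarrow> 'v set set \<Rightarrow> 'v set \<Rightarrow> ('v \<Rightarrow> 'a::real_normed_vector) \<Rightarrow> ('v \<Rightarrow> 'a) \<Rightarrow> bool" where
  "extreme_network V E B \<phi> \<Gamma> \<longleftrightarrow> is_arg_min (network_length E) (\<lambda>\<Gamma>. \<Gamma> \<in> networks V B \<phi>) \<Gamma>"

text \<open>
  \<open>c e\<close> is the vertex set of the component of \<open>G\<close> without \<open>e\<close> that is chosen in order to write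
  down the inequality belonging to the edge \<open>e\<close>.
\<close>

definition component_choice :: "'v set \<Rightarrow> 'v set set \<Rightarrow> ('v set \<Rightarrow> 'v set) \<Rightarrow> bool" where
  "component_choice V E c \<longleftrightarrow> (\<forall>e\<in>E. c e \<in> graph_components V (E - {e}))"

text \<open>
  The boundary vertices are enumerated by \<open>v\<close>, whose index type \<open>'n\<close> stands for \<open>{1, \<dots>, n}\<close>.
\<close>

definition solution_set ::
    "'v set set \<Rightarrow> ('n::finite \<Rightarrow> 'v) \<Rightarrow> ('v set \<Rightarrow> 'v set) \<Rightarrow> (real ^ 'm ^ 'n) set" where
  "solution_set E v c =
     {\<theta>. (\<Sum>k\<in>UNIV. \<theta> $ k) = 0 \<and> (\<forall>e\<in>E. (norm (\<Sum>k | v k \<in> c e. \<theta> $ k))\<^sup>2 \<le> 1)}"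

definition rho :: "('v \<Rightarrow> real ^ 'm) \<Rightarrow> ('n::finite \<Rightarrow> 'v) \<Rightarrow> real ^ 'm ^ 'n \<Rightarrow> real" where
  "rho \<phi> v \<theta> = \<theta> \<bullet> (\<chi> k. \<phi> (v k))"

end

theory Submission
  imports Defs "HOL-Library.Transitive_Closure_Table"
begin

text \<open>
  Lower bound: root the tree at \<open>r\<close>. Every edge is a bridge, so \<open>\<Gamma> x - \<Gamma> r\<close> is the sum, over the
  edges that separate \<open>x\<close> from \<open>r\<close>, of the increments of \<open>\<Gamma>\<close> along them. Since \<open>\<Sum>\<^sub>k \<theta>\<^sub>k = 0\<close>,
  exchanging sums writes \<open>\<rho>(\<theta>)\<close> as a sum over the edges of \<open>\<langle>\<Sum>\<theta>\<^sub>k, \<Gamma> w - \<Gamma> u\<rangle>\<close>, with \<open>k\<close> ranging over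
  the side of \<open>uw\<close> away from the root; each term is at most the length of the edge.

  Attainment: the infimum of the lengths of the networks with given boundary is a sublinear function
  of the boundary. A supporting functional \<open>\<theta>\<close> of it at \<open>\<phi>\<close> agrees with it at \<open>\<phi>\<close> and is below it
  everywhere. Testing \<open>\<theta>\<close> on constant networks gives \<open>\<sigma>\<close>, and testing it on networks that are constant on
  one component of \<open>G\<close> without \<open>e\<close> and vanish on the other one gives \<open>\<sigma>\<^sub>e\<close>.
\<close>

section \<open>Bridges of a tree\<close>

lemma reachable_refl [simp]: "reachable E x x"
  by (simp add: reachable_def)

lemma reachable_sym: "reachable E x y \<Longrightarrow> reachable E y x"
proof -
  have "sym {(x, y). {x, y} \<in> E}"
    by (auto simp: sym_def insert_commute)
  then have "sym ({(x, y). {x, y} \<in> E}\<^sup>*)"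
    by (rule sym_rtrancl)
  then show "reachable E x y \<Longrightarrow> reachable E y x"
    unfolding reachable_def by (rule symD)
qed

lemma reachable_trans: "reachable E x y \<Longrightarrow> reachable E y z \<Longrightarrow> reachable E x z"
  unfolding reachable_def by (rule rtrancl_trans)

lemma reachable_commute: "reachable E x y \<longleftrightarrow> reachable E y x"
  by (rule iffI; rule reachable_sym)

lemma reachable_right_iff:
  assumes "reachable E x y"
  shows "reachable E z x \<longleftrightarrow> reachable E z y"
proof
  show "reachable E z x \<Longrightarrow> reachable E z y"
    using assms by (rule reachable_trans[rotated])
  show "reachable E z y \<Longrightarrow> reachable E z x"
    using reachable_sym[OF assms] by (rule reachable_trans[rotated])
qed

lemma reachable_edge: "{x, y} \<in> E \<Longrightarrow> reachable E x y"
  unfolding reachable_def by auto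

lemma reachable_induct [consumes 1, case_names refl step]:
  assumes "reachable E x y" "P x"
    and "\<And>y z. reachable E x y \<Longrightarrow> {y, z} \<in> E \<Longrightarrow> P y \<Longrightarrow> P z"
  shows "P y"
  using assms unfolding reachable_def by (induction rule: rtrancl_induct) auto

lemma simple_graph_finite_edges:
  assumes "simple_graph V E"
  shows "finite E"
proof (rule finite_subset)
  show "E \<subseteq> Pow V" "finite (Pow V)"
    using assms unfolding simple_graph_def by fastforce+
qed

lemma simple_graph_edge:
  "simple_graph V E \<Longrightarrow> e \<in> E \<Longrightarrow> \<exists>u\<in>V. \<exists>w\<in>V. u \<noteq> w \<and> e = {u, w}"
  by (simp add: simple_graph_def)

lemma tree_simple_graph: "graph_tree V E \<Longrightarrow> simple_graph V E"
  by (simp add: graph_tree_def)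

text \<open>A walk from \<open>x\<close> to \<open>y\<close> that avoids the edge can be shortened
  to one without repeated vertices, and the edge itself closes that path to a cycle.\<close>

lemma acyclic_edge_is_bridge:
  assumes acyc: "\<nexists>p. graph_cycle E p" and e: "{x, y} \<in> E" "x \<noteq> y"
  shows "\<not> reachable (E - {{x, y}}) x y"
proof
  define R where "R = (\<lambda>a b. {a, b} \<in> E - {{x, y}})"
  assume "reachable (E - {{x, y}}) x y"
  then have "R\<^sup>*\<^sup>* x y"
    unfolding R_def reachable_def by (simp add: rtranclp_rtrancl_eq)
  then obtain xs where "rtrancl_path R x xs y"
    by (metis rtranclp_eq_rtrancl_path)
  then obtain ys where path: "rtrancl_path R x ys y" and dist: "distinct (x # ys)"
    by (rule rtrancl_path_distinct) blast
  have "ys \<noteq> []"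
    using path e(2) by (auto elim: rtrancl_path.cases)
  have last: "last ys = y"
    using rtrancl_path_last[OF path \<open>ys \<noteq> []\<close>] .
  have step: "R ((x # ys) ! i) (ys ! i)" if "i < length ys" for i
    using rtrancl_path_nth[OF path that] .
  \<comment> \<open>A path of a single step would be the removed edge; hence the cycle has at least
    three vertices.\<close>
  have "length ys \<noteq> 1"
    using step[of 0] last by (auto simp: length_Suc_conv R_def)
  then have len: "3 \<le> length (x # ys)"
    using \<open>ys \<noteq> []\<close> by (cases ys) (auto simp: Suc_le_eq)
  \<comment> \<open>The indices below \<open>length ys\<close> are steps of the path; at
    \<open>length ys\<close> the index wraps around to \<open>0\<close>, which is the closing edge
    from \<open>y\<close> to \<open>x\<close>.\<close>
  have "{(x # ys) ! i, (x # ys) ! (Suc i mod length (x # ys))} \<in> E" if "i < length (x # ys)" for i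
  proof (cases "i < length ys")
    case True
    then show ?thesis
      using step[OF True] by (simp add: R_def)
  next
    case False
    then have "i = length ys"
      using that by simp
    moreover have "(x # ys) ! length ys = y"
      using last \<open>ys \<noteq> []\<close> by (simp add: last_conv_nth nth_Cons')
    ultimately show ?thesis
      using e(1) by (simp add: insert_commute)
  qed
  then have "graph_cycle E (x # ys)"
    using len dist unfolding graph_cycle_def by blast
  with acyc show False
    by blast
qed

text \<open>Follow a walk from \<open>x\<close>: a step along the removed edge lands on
  \<open>x\<close> or \<open>y\<close>, and any other step stays in the same component.\<close>

lemma reachable_remove_edge:
  assumes "reachable E x z"
  shows "reachable (E - {{x, y}}) x z \<or> reachable (E - {{x, y}}) y z"
  using assms
proof (induction rule: reachable_induct)
  case (step a b)
  show ?case
  proof (cases "{a, b} = {x, y}")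
    case True
    then have "b = x \<or> b = y"
      by blast
    then show ?thesis
      by auto
  next
    case False
    then have "reachable (E - {{x, y}}) a b"
      using step.hyps(2) by (intro reachable_edge) simp
    from reachable_right_iff[OF this] show ?thesis
      using step.IH by simp
  qed
qed auto

text \<open>Connectedness puts \<open>z\<close> on the side of at least one end; if it were on both,
  the ends would be joined without the edge, which is a bridge.\<close>

lemma tree_remove_edge:
  assumes "graph_tree V E" "{x, y} \<in> E" "z \<in> V"
  shows "reachable (E - {{x, y}}) z x \<longleftrightarrow> \<not> reachable (E - {{x, y}}) z y"
proof -
  obtain u w where "u \<in> V" "w \<in> V" "u \<noteq> w" "{x, y} = {u, w}"
    using simple_graph_edge[OF tree_simple_graph[OF assms(1)] assms(2)] by blast
  then have xy: "x \<in> V" "x \<noteq> y"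
    by (auto simp: doubleton_eq_iff)
  have "reachable E x z"
    using assms xy unfolding graph_tree_def graph_connected_def by blast
  moreover have "\<not> reachable (E - {{x, y}}) x y"
    using assms xy by (intro acyclic_edge_is_bridge) (auto simp: graph_tree_def)
  ultimately show ?thesis
    using reachable_remove_edge[of E x z y] reachable_trans[of "E - {{x, y}}" x z y]
      reachable_commute[of "E - {{x, y}}" z] by blast
qed

text \<open>Removing \<open>e\<close> leaves just two sides, so whichever component was chosen, it
  is the root side or the complement of it.\<close>

lemma tree_component_cases:
  assumes tree: "graph_tree V E" and e: "e \<in> E" and r: "r \<in> V"
    and C: "C \<in> graph_components V (E - {e})"
  shows "C = {x \<in> V. reachable (E - {e}) r x} \<or> C = {x \<in> V. \<not> reachable (E - {e}) r x}"
proof -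
  obtain u where u: "u \<in> V" "C = {x \<in> V. reachable (E - {e}) u x}"
    using C unfolding graph_components_def by blast
  obtain a b where ab: "e = {a, b}"
    using simple_graph_edge[OF tree_simple_graph[OF tree] e] by blast
  have split: "reachable (E - {e}) z a \<longleftrightarrow> \<not> reachable (E - {e}) z b" if "z \<in> V" for z
    using tree_remove_edge[OF tree, of a b z] e ab that by simp
  \<comment> \<open>Reaching the end \<open>a\<close> or not labels the two sides, so equal labels
    mean equal components.\<close>
  have same_side: "reachable (E - {e}) y z \<longleftrightarrow> (reachable (E - {e}) y a \<longleftrightarrow> reachable (E - {e}) z a)"
    if "y \<in> V" "z \<in> V" for y z
    using split[OF that(1)] split[OF that(2)] reachable_right_iff[of "E - {e}" z a y]
      reachable_right_iff[of "E - {e}" z b y] by blast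
  show ?thesis
  proof (cases "reachable (E - {e}) r u")
    case True
    then have "C = {x \<in> V. reachable (E - {e}) r x}"
      using u same_side[OF r] same_side[OF \<open>u \<in> V\<close>] by auto
    then show ?thesis ..
  next
    case False
    then have "C = {x \<in> V. \<not> reachable (E - {e}) r x}"
      using u same_side[OF r] same_side[OF \<open>u \<in> V\<close>] by auto
    then show ?thesis ..
  qed
qed

section \<open>The lower bound\<close>

text \<open>\<open>s e\<close> is the end of \<open>e\<close> on the side of the root \<open>r\<close>, and \<open>t e\<close> is the other one.\<close>

lemma tree_telescope:
  fixes \<Gamma> :: "'v \<Rightarrow> 'a::real_normed_vector"
  assumes E: "finite E"
    and st: "\<And>e. e \<in> E \<Longrightarrow> e = {s e, t e} \<and> reachable (E - {e}) r (s e) \<and> \<not> reachable (E - {e}) r (t e)"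
    and x: "reachable E r x"
  shows "\<Gamma> x - \<Gamma> r = (\<Sum>e\<in>E. if reachable (E - {e}) r x then 0 else \<Gamma> (t e) - \<Gamma> (s e))"
  using x
proof (induction rule: reachable_induct)
  case (step x y)
  let ?f = "\<lambda>x e. if reachable (E - {e}) r x then 0 else \<Gamma> (t e) - \<Gamma> (s e)"
  let ?e = "{x, y}"
  \<comment> \<open>The step from \<open>x\<close> to \<open>y\<close> crosses no edge but itself,
    so only the term of that edge changes.\<close>
  have other: "?f y e = ?f x e" if "e \<in> E - {?e}" for e
  proof -
    have "reachable (E - {e}) x y"
      using step.hyps(2) that by (intro reachable_edge) blast
    from reachable_right_iff[OF this] show ?thesis
      by simp
  qed
  have "?f y ?e - ?f x ?e = \<Gamma> y - \<Gamma> x"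
  proof -
    have e: "?e = {s ?e, t ?e}" "reachable (E - {?e}) r (s ?e)" "\<not> reachable (E - {?e}) r (t ?e)"
      using st[OF step.hyps(2)] by blast+
    \<comment> \<open>The walk may use the edge away from the root, which adds its increment, or
      towards the root, which cancels it.\<close>
    from e(1) consider "s ?e = x" "t ?e = y" | "s ?e = y" "t ?e = x"
      unfolding doubleton_eq_iff by metis
    then show ?thesis
    proof cases
      case 1
      have "reachable (E - {?e}) r x" "\<not> reachable (E - {?e}) r y"
        using e(2,3) unfolding 1 .
      then show ?thesis
        unfolding 1 by (simp only: if_True if_False diff_zero)
    next
      case 2
      have "reachable (E - {?e}) r y" "\<not> reachable (E - {?e}) r x"
        using e(2,3) unfolding 2 .
      then show ?thesis
        unfolding 2 by (simp only: if_True if_False diff_0 minus_diff_eq)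
    qed
  qed
  moreover have "sum (?f y) E = ?f y ?e + sum (?f y) (E - {?e})"
    "sum (?f x) E = ?f x ?e + sum (?f x) (E - {?e})"
    using E step by (intro sum.remove; simp)+
  moreover have "sum (?f y) (E - {?e}) = sum (?f x) (E - {?e})"
    using other by (intro sum.cong) auto
  ultimately have "sum (?f y) E = sum (?f x) E + (\<Gamma> y - \<Gamma> x)"
    by (simp add: algebra_simps)
  also have "\<dots> = \<Gamma> y - \<Gamma> r"
    unfolding step.IH[symmetric] by simp
  finally show ?case
    by (rule sym)
qed auto

text \<open>Weak duality: each feasible \<theta> bounds from below the length of any mapping
  \<Gamma>, tested against its own boundary values.\<close>

lemma rho_le_network_length:
  fixes \<theta> :: "real ^ 'm ^ 'n::finite" and v :: "'n \<Rightarrow> 'v"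
  assumes tree: "graph_tree V E" and v: "range v \<subseteq> V" and c: "component_choice V E c"
    and \<theta>: "\<theta> \<in> solution_set E v c"
  shows "rho \<Gamma> v \<theta> \<le> network_length E \<Gamma>"
proof -
  have simple: "simple_graph V E"
    using tree by (rule tree_simple_graph)
  then have E: "finite E"
    by (rule simple_graph_finite_edges)
  obtain r where r: "r \<in> V"
    using tree by (auto simp: graph_tree_def graph_connected_def)
  \<comment> \<open>Orient every edge away from the root; the implication under the quantifiers lets
    \<open>s\<close> and \<open>t\<close> be chosen as total functions.\<close>
  have "\<forall>e. \<exists>s t. e \<in> E \<longrightarrow> e = {s, t} \<and> reachable (E - {e}) r s \<and> \<not> reachable (E - {e}) r t"
  proof (intro allI)
    fix e
    show "\<exists>s t. e \<in> E \<longrightarrow> e = {s, t} \<and> reachable (E - {e}) r s \<and> \<not> reachable (E - {e}) r t"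
    proof (cases "e \<in> E")
      case True
      then obtain a b where "e = {a, b}"
        using simple_graph_edge[OF simple] by blast
      then show ?thesis
        using tree_remove_edge[OF tree, of a b r] True r insert_commute[of a b "{}"] by blast
    qed auto
  qed
  then obtain s t where
    st: "\<And>e. e \<in> E \<Longrightarrow> e = {s e, t e} \<and> reachable (E - {e}) r (s e) \<and> \<not> reachable (E - {e}) r (t e)"
    by metis
  have sum0: "(\<Sum>k\<in>UNIV. \<theta> $ k) = 0"
    using \<theta> by (simp add: solution_set_def)
  \<comment> \<open>These are the indices of the boundary vertices that \<open>e\<close> cuts off
    from the root.\<close>
  define far where "far e = {k. \<not> reachable (E - {e}) r (v k)}" for e
  have far: "norm (\<Sum>k\<in>far e. \<theta> $ k) \<le> 1" if e: "e \<in> E" for e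
  proof -
    let ?C = "{k. v k \<in> c e}"
    have "(norm (\<Sum>k\<in>?C. \<theta> $ k))\<^sup>2 \<le> 1"
      using \<theta> e by (simp add: solution_set_def)
    then have le: "norm (\<Sum>k\<in>?C. \<theta> $ k) \<le> 1"
      by (simp add: power_le_one_iff)
    have "c e \<in> graph_components V (E - {e})"
      using c e by (simp add: component_choice_def)
    from tree_component_cases[OF tree e r this] show ?thesis
    proof
      \<comment> \<open>If the root side was chosen, the vanishing total sum turns its partial sum
        into the negative of the far one, with the same norm.\<close>
      assume "c e = {x \<in> V. reachable (E - {e}) r x}"
      then have "far e = UNIV - ?C"
        using v by (auto simp: far_def)
      then have "(\<Sum>k\<in>far e. \<theta> $ k) = - (\<Sum>k\<in>?C. \<theta> $ k)"
        using sum0 by (simp add: sum_diff)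
      then show ?thesis
        using le by simp
    next
      assume "c e = {x \<in> V. \<not> reachable (E - {e}) r x}"
      then have "far e = ?C"
        using v by (auto simp: far_def)
      then show ?thesis
        using le by simp
    qed
  qed
  have diff: "\<Gamma> (v k) - \<Gamma> r = (\<Sum>e\<in>E. if k \<in> far e then \<Gamma> (t e) - \<Gamma> (s e) else 0)" for k
  proof -
    have "reachable E r (v k)"
      using tree r v by (auto simp: graph_tree_def graph_connected_def)
    from tree_telescope[of E s t r, OF E st this, of \<Gamma>] show ?thesis
      by (auto simp: far_def intro!: sum.cong)
  qed
  have "rho \<Gamma> v \<theta> = (\<Sum>k\<in>UNIV. \<theta> $ k \<bullet> \<Gamma> (v k))"
    by (simp add: rho_def inner_vec_def)
  \<comment> \<open>Subtracting the root value costs nothing, again because the total sum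
    vanishes.\<close>
  also have "\<dots> = (\<Sum>k\<in>UNIV. \<theta> $ k \<bullet> (\<Gamma> (v k) - \<Gamma> r)) + (\<Sum>k\<in>UNIV. \<theta> $ k) \<bullet> \<Gamma> r"
    by (simp add: inner_diff_right sum_subtractf inner_sum_left)
  also have "\<dots> = (\<Sum>k\<in>UNIV. \<Sum>e\<in>E. if k \<in> far e then \<theta> $ k \<bullet> (\<Gamma> (t e) - \<Gamma> (s e)) else 0)"
    unfolding sum0 diff by (auto simp: inner_sum_right intro!: sum.cong)
  also have "\<dots> = (\<Sum>e\<in>E. \<Sum>k\<in>UNIV. if k \<in> far e then \<theta> $ k \<bullet> (\<Gamma> (t e) - \<Gamma> (s e)) else 0)"
    by (rule sum.swap)
  also have "\<dots> = (\<Sum>e\<in>E. (\<Sum>k\<in>far e. \<theta> $ k) \<bullet> (\<Gamma> (t e) - \<Gamma> (s e)))"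
    by (simp add: inner_sum_left sum.If_cases)
  also have "\<dots> \<le> (\<Sum>e\<in>E. edge_length \<Gamma> e)"
  proof (rule sum_mono)
    fix e assume e: "e \<in> E"
    have "(\<Sum>k\<in>far e. \<theta> $ k) \<bullet> (\<Gamma> (t e) - \<Gamma> (s e)) \<le> norm (\<Sum>k\<in>far e. \<theta> $ k) * norm (\<Gamma> (t e) - \<Gamma> (s e))"
      by (rule norm_cauchy_schwarz)
    also have "\<dots> \<le> norm (\<Gamma> (t e) - \<Gamma> (s e))"
      using far[OF e] by (intro mult_left_le_one_le) auto
    also have "\<dots> = edge_length \<Gamma> e"
      using st[OF e] edge_length_doubleton by (metis norm_minus_commute)
    finally show "(\<Sum>k\<in>far e. \<theta> $ k) \<bullet> (\<Gamma> (t e) - \<Gamma> (s e)) \<le> edge_length \<Gamma> e" .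
  qed
  finally show ?thesis
    by (simp add: network_length_def)
qed

section \<open>Attainment\<close>

lemma network_length_add_le:
  assumes "simple_graph V E"
  shows "network_length E (\<lambda>x. \<Gamma> x + \<Delta> x) \<le> network_length E \<Gamma> + network_length E \<Delta>"
  unfolding network_length_def sum.distrib[symmetric]
proof (rule sum_mono)
  fix e assume "e \<in> E"
  then obtain u w where "e = {u, w}"
    using simple_graph_edge[OF assms(1)] by blast
  then show "edge_length (\<lambda>x. \<Gamma> x + \<Delta> x) e \<le> edge_length \<Gamma> e + edge_length \<Delta> e"
    using norm_triangle_ineq[of "\<Gamma> u - \<Gamma> w" "\<Delta> u - \<Delta> w"] by (simp add: algebra_simps)
qed

lemma network_length_scaleR:
  assumes "simple_graph V E"
  shows "network_length E (\<lambda>x. a *\<^sub>R \<Gamma> x) = \<bar>a\<bar> * network_length E \<Gamma>"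
  unfolding network_length_def sum_distrib_left
proof (rule sum.cong)
  fix e assume "e \<in> E"
  then obtain u w where "e = {u, w}"
    using simple_graph_edge[OF assms(1)] by blast
  then show "edge_length (\<lambda>x. a *\<^sub>R \<Gamma> x) e = \<bar>a\<bar> * edge_length \<Gamma> e"
    by (simp flip: scaleR_diff_right)
qed simp

lemma network_length_cong:
  assumes "simple_graph V E" "\<And>x. x \<in> V \<Longrightarrow> \<Gamma> x = \<Delta> x"
  shows "network_length E \<Gamma> = network_length E \<Delta>"
  unfolding network_length_def
proof (rule sum.cong)
  fix e assume "e \<in> E"
  then obtain u w where "u \<in> V" "w \<in> V" "e = {u, w}"
    using simple_graph_edge[OF assms(1)] by blast
  then show "edge_length \<Gamma> e = edge_length \<Delta> e"
    using assms by simp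
qed simp

lemma network_length_const:
  assumes "simple_graph V E"
  shows "network_length E (\<lambda>_. a) = 0"
  unfolding network_length_def
proof (rule sum.neutral, rule ballI)
  fix e assume "e \<in> E"
  then obtain u w where "e = {u, w}"
    using simple_graph_edge[OF assms(1)] by blast
  then show "edge_length (\<lambda>_. a) e = 0"
    by simp
qed

text \<open>An edge other than \<open>e\<close> has both ends in \<open>C\<close> or both outside
  it, so only \<open>e\<close> can contribute, with length \<open>norm a\<close> or zero.\<close>

lemma network_length_component:
  assumes simple: "simple_graph V E" and e: "e \<in> E" and C: "C \<in> graph_components V (E - {e})"
  shows "network_length E (\<lambda>x. if x \<in> C then a else 0) \<le> norm a"
proof -
  let ?\<Gamma> = "\<lambda>x. if x \<in> C then a else 0"
  have zero: "edge_length ?\<Gamma> d = 0" if d: "d \<in> E - {e}" for d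
  proof -
    obtain u w where uw: "u \<in> V" "w \<in> V" "d = {u, w}"
      using d simple_graph_edge[OF simple] by blast
    have "reachable (E - {e}) u w"
      using d uw by (intro reachable_edge) auto
    then have "reachable (E - {e}) x u \<longleftrightarrow> reachable (E - {e}) x w" for x
      by (rule reachable_right_iff)
    then have "u \<in> C \<longleftrightarrow> w \<in> C"
      using C uw unfolding graph_components_def by auto
    then show ?thesis
      using uw by simp
  qed
  obtain u w where "e = {u, w}"
    using simple_graph_edge[OF simple e] by blast
  then have "edge_length ?\<Gamma> e \<le> norm a"
    by simp
  moreover have "network_length E ?\<Gamma> = edge_length ?\<Gamma> e + (\<Sum>d\<in>E - {e}. edge_length ?\<Gamma> d)"
    unfolding network_length_def using e simple_graph_finite_edges[OF simple] by (intro sum.remove)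
  moreover have "(\<Sum>d\<in>E - {e}. edge_length ?\<Gamma> d) = 0"
    using zero by (intro sum.neutral) blast
  ultimately show ?thesis
    by simp
qed

text \<open>Converse of weak duality: the constraints are what domination says on suitable test
  networks.\<close>

lemma dominated_functional_in_solution_set:
  fixes \<theta> :: "real ^ 'm ^ 'n::finite" and v :: "'n \<Rightarrow> 'v"
  assumes simple: "simple_graph V E" and c: "component_choice V E c"
    and dom: "\<And>\<Gamma>. rho \<Gamma> v \<theta> \<le> network_length E \<Gamma>"
  shows "\<theta> \<in> solution_set E v c"
proof -
  have rho_sum: "rho \<Gamma> v \<theta> = (\<Sum>k\<in>UNIV. \<theta> $ k \<bullet> \<Gamma> (v k))" for \<Gamma>
    by (simp add: rho_def inner_vec_def)
  let ?s = "\<Sum>k\<in>UNIV. \<theta> $ k"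
  \<comment> \<open>The constant network with value \<open>?s\<close> has length zero, while
    \<theta> takes the value \<open>?s \<bullet> ?s\<close> on it.\<close>
  have "?s \<bullet> ?s \<le> 0"
    using dom[of "\<lambda>_. ?s"] network_length_const[OF simple, of ?s]
    by (simp add: rho_sum inner_sum_left)
  then have "?s = 0"
    by (simp only: not_less[symmetric] inner_gt_zero_iff not_not)
  moreover have "(norm (\<Sum>k | v k \<in> c e. \<theta> $ k))\<^sup>2 \<le> 1" if e: "e \<in> E" for e
  proof -
    \<comment> \<open>Using the partial sum itself as the value of the test network gives
      \<open>a \<bullet> a \<le> norm a\<close>, hence \<open>norm a \<le> 1\<close>.\<close>
    define a where "a = (\<Sum>k | v k \<in> c e. \<theta> $ k)"
    have "rho (\<lambda>x. if x \<in> c e then a else 0) v \<theta> = (\<Sum>k\<in>UNIV. if v k \<in> c e then \<theta> $ k \<bullet> a else 0)"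
      unfolding rho_sum by (intro sum.cong) auto
    also have "\<dots> = a \<bullet> a"
      by (simp add: sum.If_cases inner_sum_left[symmetric] flip: a_def)
    finally have "a \<bullet> a \<le> norm a"
      using dom[of "\<lambda>x. if x \<in> c e then a else 0"] c e
        network_length_component[OF simple e, of "c e" a]
      by (simp add: component_choice_def)
    then have "norm a * norm a \<le> norm a"
      by (simp add: dot_square_norm power2_eq_square)
    then have "norm a \<le> 1"
      by (cases "a = 0") auto
    then show ?thesis
      by (simp add: power_le_one flip: a_def)
  qed
  ultimately show ?thesis
    by (simp add: solution_set_def)
qed

text \<open>A hyperplane separates the pairs of boundary values and upper length bounds from the
  points below the minimum at \<Gamma>\<open>\<^sub>0\<close>; its rescaled normal is
  \<theta>.\<close>

lemma exists_supporting_functional: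
  fixes v :: "'n::finite \<Rightarrow> 'v" and \<Gamma>\<^sub>0 :: "'v \<Rightarrow> real ^ 'm"
  assumes simple: "simple_graph V E" and v: "inj v"
    and min: "\<And>\<Gamma>. \<forall>k. \<Gamma> (v k) = \<Gamma>\<^sub>0 (v k) \<Longrightarrow> network_length E \<Gamma>\<^sub>0 \<le> network_length E \<Gamma>"
  obtains \<theta> :: "real ^ 'm ^ 'n"
  where "\<And>\<Gamma>. rho \<Gamma> v \<theta> \<le> network_length E \<Gamma>" "network_length E \<Gamma>\<^sub>0 \<le> rho \<Gamma>\<^sub>0 v \<theta>"
proof -
  define bd :: "('v \<Rightarrow> real ^ 'm) \<Rightarrow> real ^ 'm ^ 'n" where "bd \<Gamma> = (\<chi> k. \<Gamma> (v k))" for \<Gamma>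
  \<comment> \<open>This plays the part of the epigraph of the infimum, but lists the networks
    themselves, so no infimum has to be formed.\<close>
  define epi where "epi = {(bd \<Gamma>, l) | \<Gamma> l. network_length E \<Gamma> \<le> l}"
  define L where "L = network_length E \<Gamma>\<^sub>0"
  \<comment> \<open>The ray is open at \<open>L\<close>, so minimality of
    \<Gamma>\<open>\<^sub>0\<close> keeps it disjoint from \<open>epi\<close>.\<close>
  define ray where "ray = {bd \<Gamma>\<^sub>0} \<times> {..<L}"
  have epiI: "(bd \<Gamma>, l) \<in> epi" if "network_length E \<Gamma> \<le> l" for \<Gamma> l
    using that by (auto simp: epi_def)
  have "convex epi"
  proof (rule convexI)
    fix p q :: "(real ^ 'm ^ 'n) \<times> real" and a b :: real
    assume "p \<in> epi" "q \<in> epi" and ab: "0 \<le> a" "0 \<le> b"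
    then obtain \<Gamma> l \<Delta> m where p: "p = (bd \<Gamma>, l)" "network_length E \<Gamma> \<le> l"
      and q: "q = (bd \<Delta>, m)" "network_length E \<Delta> \<le> m"
      by (auto simp: epi_def)
    have "network_length E (\<lambda>x. a *\<^sub>R \<Gamma> x + b *\<^sub>R \<Delta> x) \<le> a * network_length E \<Gamma> + b * network_length E \<Delta>"
      using network_length_add_le[OF simple, of "\<lambda>x. a *\<^sub>R \<Gamma> x" "\<lambda>x. b *\<^sub>R \<Delta> x"] ab
      by (simp add: network_length_scaleR[OF simple])
    also have "\<dots> \<le> a * l + b * m"
      using p q ab by (intro add_mono mult_left_mono)
    finally have "(bd (\<lambda>x. a *\<^sub>R \<Gamma> x + b *\<^sub>R \<Delta> x), a * l + b * m) \<in> epi"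
      by (rule epiI)
    moreover have "bd (\<lambda>x. a *\<^sub>R \<Gamma> x + b *\<^sub>R \<Delta> x) = a *\<^sub>R bd \<Gamma> + b *\<^sub>R bd \<Delta>"
      by (simp add: bd_def vec_eq_iff)
    ultimately show "a *\<^sub>R p + b *\<^sub>R q \<in> epi"
      by (simp add: p q)
  qed
  moreover have "convex ray"
    unfolding ray_def by (intro convex_Times) auto
  moreover have "ray \<noteq> {}" "epi \<noteq> {}"
    using epiI by (auto simp: ray_def lessThan_non_empty)
  moreover have "ray \<inter> epi = {}"
  proof (rule ccontr)
    assume "ray \<inter> epi \<noteq> {}"
    then obtain \<Gamma> l where "bd \<Gamma> = bd \<Gamma>\<^sub>0" "network_length E \<Gamma> \<le> l" "l < L"
      by (auto simp: ray_def epi_def) metis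
    then show False
      using min[of \<Gamma>] by (auto simp: bd_def vec_eq_iff L_def)
  qed
  ultimately obtain p b where p: "p \<noteq> 0" "\<forall>x\<in>ray. p \<bullet> x \<le> b" "\<forall>x\<in>epi. b \<le> p \<bullet> x"
    using separating_hyperplane_sets[of ray epi] by metis
  obtain \<alpha> \<beta> where \<alpha>\<beta>: "p = (\<alpha>, \<beta>)"
    by (cases p)
  have below: "\<alpha> \<bullet> bd \<Gamma>\<^sub>0 + \<beta> * l \<le> b" if "l < L" for l
    using p(2) that by (auto simp: ray_def \<alpha>\<beta>)
  have above: "b \<le> \<alpha> \<bullet> bd \<Gamma> + \<beta> * l" if "network_length E \<Gamma> \<le> l" for \<Gamma> l
    using p(3) epiI[OF that] by (auto simp: \<alpha>\<beta>)
  \<comment> \<open>As \<open>epi\<close> is stable under nonnegative scaling, a negative value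
    could be scaled below \<open>b\<close>; the factor \<open>a\<close> makes it
    \<open>- (\<bar>b\<bar> + 1)\<close>.\<close>
  have cone: "0 \<le> \<alpha> \<bullet> bd \<Gamma> + \<beta> * l" if l: "network_length E \<Gamma> \<le> l" for \<Gamma> l
  proof (rule ccontr)
    let ?x = "\<alpha> \<bullet> bd \<Gamma> + \<beta> * l"
    assume "\<not> 0 \<le> ?x"
    then have neg: "?x < 0"
      by simp
    define a where "a = (\<bar>b\<bar> + 1) / - ?x"
    have a: "0 \<le> a"
      using neg unfolding a_def by (intro divide_nonneg_pos) auto
    have "network_length E (\<lambda>x. a *\<^sub>R \<Gamma> x) \<le> a * l"
      using l a by (simp add: network_length_scaleR[OF simple] mult_left_mono)
    then have "b \<le> \<alpha> \<bullet> bd (\<lambda>x. a *\<^sub>R \<Gamma> x) + \<beta> * (a * l)"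
      by (rule above)
    moreover have "bd (\<lambda>x. a *\<^sub>R \<Gamma> x) = a *\<^sub>R bd \<Gamma>"
      by (simp add: bd_def vec_eq_iff)
    ultimately have "b \<le> a * ?x"
      by (simp add: algebra_simps)
    moreover have "a * - ?x = \<bar>b\<bar> + 1"
      using neg by (intro nonzero_eq_divide_eq[THEN iffD1, OF _ a_def]) linarith
    then have "a * ?x = - (\<bar>b\<bar> + 1)"
      unfolding mult_minus_right by linarith
    ultimately show False
      by linarith
  qed
  have zero: "bd (\<lambda>_. 0) = 0" "network_length E (\<lambda>_. 0 :: real ^ 'm) = 0"
    using network_length_const[OF simple] by (auto simp: bd_def vec_eq_iff)
  have "b \<le> 0"
    using above[of "\<lambda>_. 0" 0] zero by simp
  have "0 \<le> \<beta>"
    using cone[of "\<lambda>_. 0" 1] zero by simp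
  \<comment> \<open>The hyperplane is not vertical: injectivity of \<open>v\<close> makes
    \<open>- \<alpha>\<close> the boundary of some network, so \<beta> = 0 would force \<alpha> = 0
    and a zero normal.\<close>
  moreover have "\<beta> \<noteq> 0"
  proof
    assume "\<beta> = 0"
    define \<Gamma> where "\<Gamma> x = - (\<alpha> $ inv v x)" for x
    have "bd \<Gamma> = - \<alpha>"
      using v by (simp add: bd_def \<Gamma>_def vec_eq_iff)
    then have "\<alpha> \<bullet> \<alpha> \<le> 0"
      using cone[of \<Gamma> "network_length E \<Gamma>"] \<open>\<beta> = 0\<close> by simp
    then have "\<alpha> = 0"
      by (simp only: not_less[symmetric] inner_gt_zero_iff not_not)
    then show False
      using p(1) \<open>\<beta> = 0\<close> by (simp add: \<alpha>\<beta> zero_prod_def)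
  qed
  ultimately have \<beta>: "0 < \<beta>"
    by simp
  define \<theta> where "\<theta> = (- 1 / \<beta>) *\<^sub>R \<alpha>"
  have rho: "rho \<Gamma> v \<theta> = - (\<alpha> \<bullet> bd \<Gamma>) / \<beta>" for \<Gamma>
    by (simp add: rho_def \<theta>_def bd_def)
  show ?thesis
  proof (rule that)
    show "rho \<Gamma> v \<theta> \<le> network_length E \<Gamma>" for \<Gamma>
      using cone[of \<Gamma> "network_length E \<Gamma>"] unfolding rho pos_divide_le_eq[OF \<beta>]
      by (simp add: mult.commute)
    \<comment> \<open>Separation speaks only of levels strictly below \<open>L\<close>; density of
      the reals then reaches \<open>L\<close>.\<close>
    have "l \<le> rho \<Gamma>\<^sub>0 v \<theta>" if "l < L" for l
      using below[OF that] \<open>b \<le> 0\<close> unfolding rho pos_le_divide_eq[OF \<beta>]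
      by (simp add: mult.commute)
    then show "network_length E \<Gamma>\<^sub>0 \<le> rho \<Gamma>\<^sub>0 v \<theta>"
      unfolding L_def by (rule dense_le)
  qed
qed

section \<open>Convexity and the duality theorem\<close>

lemma convex_solution_set:
  fixes v :: "'n::finite \<Rightarrow> 'v"
  shows "convex (solution_set E v c :: (real ^ 'm ^ 'n) set)"
proof (rule convexI)
  fix \<theta> \<eta> :: "real ^ 'm ^ 'n" and a b :: real
  assume \<theta>: "\<theta> \<in> solution_set E v c" and \<eta>: "\<eta> \<in> solution_set E v c"
    and ab: "0 \<le> a" "0 \<le> b" "a + b = 1"
  \<comment> \<open>Partial sums are linear for any index set, which serves the equation and the
    inequalities; the latter then reduce to convexity of the unit ball.\<close>
  have lin: "(\<Sum>k\<in>K. (a *\<^sub>R \<theta> + b *\<^sub>R \<eta>) $ k) = a *\<^sub>R (\<Sum>k\<in>K. \<theta> $ k) + b *\<^sub>R (\<Sum>k\<in>K. \<eta> $ k)" for K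
    by (simp add: sum.distrib scaleR_sum_right)
  have "norm (\<Sum>k | v k \<in> c e. (a *\<^sub>R \<theta> + b *\<^sub>R \<eta>) $ k) \<le> 1" if "e \<in> E" for e
  proof -
    have "norm (\<Sum>k | v k \<in> c e. \<theta> $ k) \<le> 1" "norm (\<Sum>k | v k \<in> c e. \<eta> $ k) \<le> 1"
      using \<theta> \<eta> that by (auto simp: solution_set_def power_le_one_iff)
    then show ?thesis
      unfolding lin using convexD[OF convex_cball[of 0 1] _ _ ab] by simp
  qed
  then show "a *\<^sub>R \<theta> + b *\<^sub>R \<eta> \<in> solution_set E v c"
    using \<theta> \<eta> unfolding solution_set_def mem_Collect_eq lin[of UNIV] by (auto simp: power_le_one)
qed

theorem theorem1:
  fixes V :: "'v set" and E :: "'v set set" and B :: "'v set"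
    and v :: "'n::finite \<Rightarrow> 'v" and \<phi> :: "'v \<Rightarrow> real ^ 'm" and c :: "'v set \<Rightarrow> 'v set"
  assumes "graph_tree V E"
    and "graph_boundary V E B"
    and "bij_betw v UNIV B"
    and "component_choice V E c"
  shows "convex (solution_set E v c :: (real ^ 'm ^ 'n) set) \<and>
    (\<forall>\<Gamma>. extreme_network V E B \<phi> \<Gamma> \<longrightarrow>
      (\<exists>\<theta>\<in>solution_set E v c. rho \<phi> v \<theta> = network_length E \<Gamma>) \<and>
      (\<forall>\<theta>\<in>solution_set E v c. rho \<phi> v \<theta> \<le> network_length E \<Gamma>))"
proof (intro conjI allI impI)
  show "convex (solution_set E v c :: (real ^ 'm ^ 'n) set)"
    by (rule convex_solution_set)
next
  fix \<Gamma> assume ext: "extreme_network V E B \<phi> \<Gamma>"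
  have simple: "simple_graph V E"
    using assms(1) by (rule tree_simple_graph)
  have v: "inj v" "range v = B" "range v \<subseteq> V"
    using assms(2,3) by (auto simp: bij_betw_def graph_boundary_def)
  have bd: "\<Gamma> (v k) = \<phi> (v k)" for k
    using ext v by (auto simp: extreme_network_def is_arg_min_def networks_def)
  \<comment> \<open>Only boundary values enter \<open>rho\<close>, so \<phi> may be traded for
    \<Gamma>.\<close>
  then have rho: "rho \<phi> v \<theta> = rho \<Gamma> v \<theta>" for \<theta>
    by (simp add: rho_def)
  show le: "\<forall>\<theta>\<in>solution_set E v c. rho \<phi> v \<theta> \<le> network_length E \<Gamma>"
    unfolding rho using rho_le_network_length[OF assms(1) v(3) assms(4)] by blast
  \<comment> \<open>Competitors here are arbitrary total functions, while \<open>networks\<close>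
    fixes the default value outside \<open>V\<close>; restricting to \<open>V\<close> bridges the
    gap and keeps the length.\<close>
  have min: "network_length E \<Gamma> \<le> network_length E \<Delta>" if "\<forall>k. \<Delta> (v k) = \<Gamma> (v k)" for \<Delta>
  proof -
    have "restrict \<Delta> V \<in> networks V B \<phi>"
      using that bd v by (auto simp: networks_def)
    then have "network_length E \<Gamma> \<le> network_length E (restrict \<Delta> V)"
      using ext by (auto simp: extreme_network_def is_arg_min_def not_less)
    also have "\<dots> = network_length E \<Delta>"
      by (intro network_length_cong[OF simple]) simp
    finally show ?thesis .
  qed
  obtain \<theta> :: "real ^ 'm ^ 'n" where \<theta>: "\<And>\<Delta>. rho \<Delta> v \<theta> \<le> network_length E \<Delta>"
    "network_length E \<Gamma> \<le> rho \<Gamma> v \<theta>"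
    using exists_supporting_functional[OF simple v(1) min] by blast
  then have "\<theta> \<in> solution_set E v c"
    by (intro dominated_functional_in_solution_set[OF simple assms(4)])
  moreover have "rho \<phi> v \<theta> = network_length E \<Gamma>"
    using \<theta> rho by (intro antisym) auto
  ultimately show "\<exists>\<theta>\<in>solution_set E v c. rho \<phi> v \<theta> = network_length E \<Gamma>"
    by blast
qed

end
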